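(* For each integer $n\ge 1$ let $V_n:\{0,1,\dots,n\}\to\mathbb R$ be a function such that the finite sequence $\{V_n(r)\}_{r=0}^n$ is unimodal. Put $\Delta_n(r)=V_n(r)-V_n(r-1)$ for $r\in\{1,\dots,n\}$. Suppose there exist a sequence $\{k_n\}_{n\ge1}$ of positive constants and constants $A<0$, $c\in(0,1)$, $\ell\in(0,1)$ such that the rescaled increments $D_n(r)=k_n\Delta_n(r)$ satisfy $$\varepsilon_n:=\sup_{\substack{|u|<2\\ \ell n+u\in\{1,\dots,n\}}}\left|D_n(\ell n+u)-A(u-c)\right|\longrightarrow 0\qquad (n\to\infty).$$ Let $(p_j,q_j)_{j\ge1}$ be a sequence of integer pairs such that $q_j\to\infty$ and $p_j-\ell q_j\to0$. Then for all sufficiently large $j$, $p_j$ is the unique optimal threshold for parameter $q_j$, i.e. $p_j\in\{0,\dots,q_j\}$ and $p_j$ is the unique maximizer of $V_{q_j}$ over $\{0,1,\dots,q_j\}$.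
   Context: A finite real sequence $\{V(r)\}_{r=0}^n$ is unimodal if there exist $0\le a\le b\le n$ with $V(0)\le\cdots\le V(a)=\cdots=V(b)\ge\cdots\ge V(n)$. The supremum defining $\varepsilon_n$ is over real $u$ with $|u|<2$ such that $\ell n+u$ is an integer in $\{1,\dots,n\}$. (In the applications, $V_n(r)$ is the expected payoff of a stopping rule with integer threshold $r\in\{0,\dots,n\}$ in a single-threshold problem with parameter $n$; a threshold is optimal if it maximizes $V_n$.) *)

theory Defs
  imports Complex_Main
begin

definition unimodal :: "nat \<Rightarrow> (nat \<Rightarrow> real) \<Rightarrow> bool" where
  "unimodal n f \<longleftrightarrow>
    (\<exists>a b. a \<le> b \<and> b \<le> n \<and>
      mono_on {0..a} f \<and> (\<forall>r\<in>{a..b}. f r = f a) \<and> antimono_on {b..n} f)"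

(* Only used for r \<ge> 1, where the subtraction on nat does not truncate. *)
definition increment :: "(nat \<Rightarrow> nat \<Rightarrow> real) \<Rightarrow> nat \<Rightarrow> nat \<Rightarrow> real" where
  "increment V n r = V n r - V n (r - 1)"

definition rescaled_increment ::
  "(nat \<Rightarrow> real) \<Rightarrow> (nat \<Rightarrow> nat \<Rightarrow> real) \<Rightarrow> nat \<Rightarrow> nat \<Rightarrow> real" where
  "rescaled_increment k V n r = k n * increment V n r"

(* The supremum over all real u with \<bar>u\<bar> < 2 such that l * n + u is an integer r in {1..n}.
   For 0 < l < 1 and n \<ge> 1 the set is finite and nonempty (r = ceiling (l * n) is admissible),
   so Sup on the reals is the genuine supremum; at n = 0 the value is immaterial. *)
definition linear_error ::
  "(nat \<Rightarrow> nat \<Rightarrow> real) \<Rightarrow> real \<Rightarrow> real \<Rightarrow> real \<Rightarrow> nat \<Rightarrow> real" where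
  "linear_error D A c l n =
    Sup {\<bar>D n r - A * (u - c)\<bar> | u r. \<bar>u\<bar> < 2 \<and> l * real n + u = real r \<and> r \<in> {1..n}}"

definition optimal_threshold :: "(nat \<Rightarrow> nat \<Rightarrow> real) \<Rightarrow> nat \<Rightarrow> nat \<Rightarrow> bool" where
  "optimal_threshold V n r \<longleftrightarrow> is_arg_max (V n) (\<lambda>s. s \<in> {0..n}) r"

end

(* If p - l n is small, the increments of V n at p and p + 1 have the signs of -A c > 0 and
   A (1 - c) < 0, so p is a strict local maximum; by unimodality it is the unique global one. *)
theory Submission
  imports Defs
begin

text \<open>A unimodal sequence can only have a strict interior local maximum at a plateau
  consisting of that single point, so such a point is the unique global maximizer
  (\<open>unimodal_strict_local_max_imp_global\<close>). It remains to find the signs of two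
  increments. With u = p - l q near 0, the rescaled increments at p and p + 1 are close to A(u - c)
  > 0 and A(u + 1 - c) < 0, with a margin that the vanishing uniform error eventually cannot bridge;
  as k > 0, rescaling preserves signs (\<open>optimal_threshold_unique\<close>).\<close>

lemma unimodal_strict_local_max_imp_global:
  assumes uni: "unimodal n f" and m: "m \<in> {1..<n}"
    and left: "f (m - 1) < f m" and right: "f (m + 1) < f m"
    and s: "s \<le> n" "s \<noteq> m"
  shows "f s < f m"
proof -
  obtain a b where ab: "a \<le> b" "b \<le> n" and up: "mono_on {0..a} f"
    and flat: "\<And>r. r \<in> {a..b} \<Longrightarrow> f r = f a" and down: "antimono_on {b..n} f"
    using uni unfolding unimodal_def by blast
  have up': "f x \<le> f y" if "x \<le> y" "y \<le> a" for x y
    using monotone_onD[OF up, of x y] that by simp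
  have down': "f y \<le> f x" if "b \<le> x" "x \<le> y" "y \<le> n" for x y
    using monotone_onD[OF down, of x y] that by simp
  \<comment> \<open>Each strict inequality excludes two positions of m: the rise into m rules out
    that m - 1 and m both lie on the descent or both on the plateau, and the drop after m does the
    same for m, m + 1 with the ascent and the plateau.\<close>
  have "m \<le> b" using down'[of "m - 1" m] left m by fastforce
  moreover have "a \<le> m" using up'[of m "m + 1"] right by fastforce
  moreover have "\<not> a < m"
    using flat[of "m - 1"] flat[of m] left \<open>m \<le> b\<close> by fastforce
  moreover have "\<not> m < b"
    using flat[of "m + 1"] flat[of m] right \<open>a \<le> m\<close> by fastforce
  ultimately have "a = m" "b = m" by auto
  show ?thesis
  proof (cases "s < m")
    case True
    then have "f s \<le> f (m - 1)" using up'[of s "m - 1"] \<open>a = m\<close> by simp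
    then show ?thesis using left by simp
  next
    case False
    then have "f s \<le> f (m + 1)" using down'[of "m + 1" s] \<open>b = m\<close> s by simp
    then show ?thesis using right by simp
  qed
qed

lemma abs_diff_le_linear_error:
  assumes "r \<in> {1..n}" "\<bar>real r - l * real n\<bar> < 2"
  shows "\<bar>D n r - A * (real r - l * real n - c)\<bar> \<le> linear_error D A c l n"
  unfolding linear_error_def
proof (rule cSup_upper)
  let ?S = "{\<bar>D n r - A * (u - c)\<bar> | u r. \<bar>u\<bar> < 2 \<and> l * real n + u = real r \<and> r \<in> {1..n}}"
  show "\<bar>D n r - A * (real r - l * real n - c)\<bar> \<in> ?S"
    using assms by (intro CollectI exI[of _ "real r - l * real n"] exI[of _ r]) simp
  \<comment> \<open>Since u is determined by r, the set is finite, hence bounded above; on the reals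
    \<open>Sup\<close> is an upper bound only for such sets.\<close>
  have "?S \<subseteq> (\<lambda>r. \<bar>D n r - A * (real r - l * real n - c)\<bar>) ` {1..n}"
  proof clarify
    fix u :: real and r
    assume "l * real n + u = real r" "r \<in> {1..n}"
    then show "\<bar>D n r - A * (u - c)\<bar> \<in> (\<lambda>r. \<bar>D n r - A * (real r - l * real n - c)\<bar>) ` {1..n}"
      by (intro image_eqI[of _ _ r]) (auto simp flip: \<open>l * real n + u = real r\<close>)
  qed
  then show "bdd_above ?S"
    by (meson bdd_above_finite finite_atLeastAtMost finite_imageI finite_subset)
qed

text \<open>The number d serves both as the bound on the offset u = m - l n and, scaled by -A, as
  the bound on the error. The two deviations add up to at most 2 d, which must fit into the
  distances c and 1 - c from the zero of A(u - c) to u = 0 and u = 1.\<close>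

lemma optimal_threshold_unique:
  assumes "unimodal n (V n)" "k n > 0" "A < 0"
    and m: "m \<in> {1..<n}"
    and d: "d < 1 / 2" "2 * d \<le> c" "2 * d \<le> 1 - c"
    and close: "\<bar>real m - l * real n\<bar> < d"
    and err: "linear_error (rescaled_increment k V) A c l n < - A * d"
  shows "optimal_threshold V n r \<longleftrightarrow> r = m"
proof -
  let ?D = "rescaled_increment k V" and ?u = "real m - l * real n"
  have "\<bar>?D n m - A * (?u - c)\<bar> < - A * d"
    using abs_diff_le_linear_error[of m n l ?D A c] m close d err by simp
  \<comment> \<open>The error bound puts the rescaled increment above this product, whose second
    factor is less than 2 d - c \<le> 0.\<close>
  moreover have "A * (?u - c + d) > 0"
    using \<open>A < 0\<close> close d by (intro mult_neg_neg) auto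
  ultimately have "k n * increment V n m > 0"
    unfolding rescaled_increment_def by (simp add: algebra_simps abs_less_iff)
  then have left: "V n (m - 1) < V n m"
    using \<open>k n > 0\<close> by (simp add: increment_def zero_less_mult_iff)
  \<comment> \<open>The offset of m + 1 is u + 1, still inside the window of radius 2.\<close>
  have "\<bar>real (m + 1) - l * real n\<bar> < 2"
    using close d by auto
  then have "\<bar>?D n (m + 1) - A * (?u + 1 - c)\<bar> < - A * d"
    using abs_diff_le_linear_error[of "m + 1" n l ?D A c] m err by (simp add: algebra_simps)
  moreover have "A * (?u + 1 - c - d) < 0"
    using \<open>A < 0\<close> close d by (intro mult_neg_pos) auto
  ultimately have "k n * increment V n (m + 1) < 0"
    unfolding rescaled_increment_def by (simp add: algebra_simps abs_less_iff)
  then have right: "V n (m + 1) < V n m"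
    using \<open>k n > 0\<close> by (simp add: increment_def mult_less_0_iff)
  have "V n s < V n m" if "s \<le> n" "s \<noteq> m" for s
    using unimodal_strict_local_max_imp_global[OF assms(1) m left right that] .
  then show ?thesis
    using m unfolding optimal_threshold_def is_arg_max_def
    by (metis atLeast0AtMost atLeastLessThan_iff atMost_iff less_imp_le order_less_asym)
qed

theorem theorem2p1:
  fixes V :: "nat \<Rightarrow> nat \<Rightarrow> real"
    and k :: "nat \<Rightarrow> real"
    and A c l :: real
    and p q :: "nat \<Rightarrow> int"
  assumes "\<And>n. n \<ge> 1 \<Longrightarrow> unimodal n (V n)"
    and "\<And>n. n \<ge> 1 \<Longrightarrow> k n > 0"
    and "A < 0"
    and "c \<in> {0<..<1}"
    and "l \<in> {0<..<1}"
    and "linear_error (rescaled_increment k V) A c l \<longlonglongrightarrow> 0"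
    and "filterlim q at_top sequentially"
    and "(\<lambda>j. real_of_int (p j) - l * real_of_int (q j)) \<longlonglongrightarrow> 0"
  shows "\<forall>\<^sub>F j in sequentially.
    p j \<in> {0..q j} \<and>
    (\<forall>r. optimal_threshold V (nat (q j)) r \<longleftrightarrow> r = nat (p j))"
proof -
  define d where "d = min c (1 - c) / 2"
  have d: "0 < d" "d < 1 / 2" "2 * d \<le> c" "2 * d \<le> 1 - c"
    using \<open>c \<in> {0<..<1}\<close> by (auto simp: d_def min_def)
  have "0 < - A * d" using \<open>A < 0\<close> d by (simp add: mult_neg_pos)
  then have "\<forall>\<^sub>F n in sequentially. linear_error (rescaled_increment k V) A c l n < - A * d"
    using assms(6) by (rule order_tendstoD(2)[rotated])
  moreover have "filterlim (\<lambda>j. nat (q j)) sequentially sequentially"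
    using filterlim_compose[OF filterlim_nat_sequentially assms(7)] .
  ultimately have err: "\<forall>\<^sub>F j in sequentially.
      linear_error (rescaled_increment k V) A c l (nat (q j)) < - A * d"
    by (rule eventually_compose_filterlim)
  have close: "\<forall>\<^sub>F j in sequentially. \<bar>real_of_int (p j) - l * real_of_int (q j)\<bar> < d"
    using tendstoD[OF assms(8) \<open>0 < d\<close>] by simp
  \<comment> \<open>These bounds make l q and (1 - l) q at least 1, so an integer within d < 1/2 of
    l q lies strictly between 0 and q, and both p and p + 1 are in {1..q}.\<close>
  have large: "\<forall>\<^sub>F j in sequentially. max \<lceil>1 / l\<rceil> \<lceil>1 / (1 - l)\<rceil> \<le> q j"
    using assms(7) unfolding filterlim_at_top by blast
  show ?thesis
    using err close large
  proof eventually_elim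
    case (elim j)
    have "1 / l \<le> real_of_int (q j)" "1 / (1 - l) \<le> real_of_int (q j)"
      using elim(3) by (simp_all add: ceiling_le_iff)
    then have lq: "1 \<le> l * real_of_int (q j)" "1 \<le> (1 - l) * real_of_int (q j)"
      using assms(5) by (simp_all add: field_simps)
    then have p: "0 < p j" "p j < q j"
      using elim(2) d by (simp_all add: algebra_simps)
    show ?case
      using optimal_threshold_unique[of "nat (q j)" V k A "nat (p j)" d c l] assms(1-3) d p elim
      by auto
  qed
qed

end
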